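(* Let $p,q\ge1$ be integers with $p\le q+1$, let $\Re(\beta_q)>\Re(\alpha_p)>0$, and let $\Re(b)>0$, $\Re(d)>0$. Then, for parameters and $z$ for which the extended generalized hypergeometric function is defined, $$ {}_{p}F_{q}^{(\kappa_l)}\left[\begin{array}{ccc}\alpha_1&\cdots&\alpha_p\\ \beta_1&\cdots&\beta_q\end{array};z;b,d\right]=\frac{\Gamma(\beta_q)}{\Gamma(\alpha_p)\Gamma(\beta_q-\alpha_p)}\int_0^1t^{\alpha_p-1}(1-t)^{\beta_q-\alpha_p-1}\;{}_{p-1}F_{q-1}^{(\kappa_l)}\left[\begin{array}{ccc}\alpha_1&\cdots&\alpha_{p-1}\\ \beta_1&\cdots&\beta_{q-1}\end{array};zt;b,d\right]\Theta\left(-\frac bt-\frac d{1-t}\right)dt . $$ The formula also holds when $b=d=0$, provided that $|\arg(1-z)|<\pi$.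
   Context: Here $(a)_m=\Gamma(a+m)/\Gamma(a)$ is the Pochhammer symbol and $B(\cdot,\cdot)$ is Euler's beta function. Let $\{\kappa_l\}_{l\ge0}$ be a complex sequence with $\kappa_0=1$ and let $\Theta(z)=\Theta(\kappa_l;z)$ be a function analytic in a disk $|z|<R$ ($0<R<\infty$) with $\Theta(z)=\sum_{l\ge0}\kappa_l z^l/l!$ there, continued analytically to the half-plane $\Re(z)>0$ with $\Theta(z)=M_0z^{\omega}e^{z}[1+O(1/z)]$ as $\Re(z)\to\infty$ ($M_0>0$, $\omega\in\mathbb{C}$). It is also understood that $\Theta$ is defined and continuous on $\Re(z)\le 0$ and that the following integrals converge absolutely. For $\Re(b),\Re(d)\ge0$ and $\Re(\alpha),\Re(\beta)>0$, $$\mathcal{B}^{(\kappa_l)}_{b,d}(\alpha,\beta)=\int_0^1t^{\alpha-1}(1-t)^{\beta-1}\Theta\left(-\frac bt-\frac d{1-t}\right)dt .$$ The extended generalized hypergeometric function ${}_pF_q^{(\kappa_l)}\left[\begin{array}{ccc}\alpha_1&\cdots&\alpha_p\\ \beta_1&\cdots&\beta_q\end{array};z;b,d\right]$ is defined by: (i) if $p=q+1$, $|z|<1$, $\Re(\beta_j)>\Re(\alpha_{j+1})>0$ for $1\le j\le q$: $\displaystyle\sum_{m\ge0}(\alpha_1)_m\prod_{j=1}^q\frac{\mathcal{B}^{(\kappa_l)}_{b,d}(\alpha_{j+1}+m,\beta_j-\alpha_{j+1})}{B(\alpha_{j+1},\beta_j-\alpha_{j+1})}\frac{z^m}{m!}$;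 (ii) if $p=q$, $z\in\mathbb{C}$, $\Re(\beta_j)>\Re(\alpha_j)>0$ for $1\le j\le q$: $\displaystyle\sum_{m\ge0}\prod_{j=1}^q\frac{\mathcal{B}^{(\kappa_l)}_{b,d}(\alpha_j+m,\beta_j-\alpha_j)}{B(\alpha_j,\beta_j-\alpha_j)}\frac{z^m}{m!}$; (iii) if $p<q$, $r=q-p$, $z\in\mathbb{C}$, $\Re(\beta_{r+j})>\Re(\alpha_j)>0$ for $1\le j\le p$, and none of $\beta_1,\dots,\beta_r$ is zero or a negative integer: $\displaystyle\sum_{m\ge0}\frac1{(\beta_1)_m\cdots(\beta_r)_m}\prod_{j=1}^p\frac{\mathcal{B}^{(\kappa_l)}_{b,d}(\alpha_j+m,\beta_{r+j}-\alpha_j)}{B(\alpha_j,\beta_{r+j}-\alpha_j)}\frac{z^m}{m!}$. Empty products equal $1$. *)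

theory Defs
  imports "HOL-Complex_Analysis.Complex_Analysis" "HOL-Library.Landau_Symbols"
begin

definition ext_beta_integrand ::
  "(complex \<Rightarrow> complex) \<Rightarrow> complex \<Rightarrow> complex \<Rightarrow> complex \<Rightarrow> complex \<Rightarrow> real \<Rightarrow> complex" where
  "ext_beta_integrand \<Theta> b d x y t =
     of_real t powr (x - 1) * of_real (1 - t) powr (y - 1) *
     \<Theta> (- (b / of_real t) - d / of_real (1 - t))"

definition ext_Beta ::
  "(complex \<Rightarrow> complex) \<Rightarrow> complex \<Rightarrow> complex \<Rightarrow> complex \<Rightarrow> complex \<Rightarrow> complex" where
  "ext_Beta \<Theta> b d x y = (LBINT t:{0<..<1}. ext_beta_integrand \<Theta> b d x y t)"

text \<open>
  The standing assumptions on \<open>\<Theta>\<close>.  The union of the disk and the right half-plane is connected, so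
  holomorphy on it says that the values on the half-plane continue the power series.
  The asymptotic expansion is uniform in the imaginary part; powers are principal.  The last clause
  is absolute convergence of the integrals defining \<open>ext_Beta\<close>.
\<close>
definition ext_kernel ::
  "(nat \<Rightarrow> complex) \<Rightarrow> real \<Rightarrow> real \<Rightarrow> complex \<Rightarrow> (complex \<Rightarrow> complex) \<Rightarrow> bool" where
  "ext_kernel \<kappa> R M \<omega> \<Theta> \<longleftrightarrow>
     \<kappa> 0 = 1 \<and> 0 < R \<and> 0 < M \<and>
     (\<forall>z. norm z < R \<longrightarrow> (\<lambda>l. \<kappa> l * z ^ l / fact l) sums \<Theta> z) \<and>
     \<Theta> holomorphic_on (ball 0 R \<union> {z. Re z > 0}) \<and>
     (\<exists>h. h \<in> O[filtercomap Re at_top](\<lambda>z. 1 / z) \<and>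
          (\<forall>z. Re z > 0 \<longrightarrow> \<Theta> z = of_real M * z powr \<omega> * exp z * (1 + h z))) \<and>
     continuous_on {z. Re z \<le> 0} \<Theta> \<and>
     (\<forall>b d x y. Re b \<ge> 0 \<longrightarrow> Re d \<ge> 0 \<longrightarrow> Re x > 0 \<longrightarrow> Re y > 0 \<longrightarrow>
        set_integrable lborel {0<..<1} (ext_beta_integrand \<Theta> b d x y))"

text \<open>
  The parameters are \<open>\<alpha> 1, \<dots>, \<alpha> p\<close> and \<open>\<beta> 1, \<dots>, \<beta> q\<close>; other values of \<open>\<alpha>\<close> and \<open>\<beta>\<close> are irrelevant,
  so dropping the last upper and lower parameter amounts to passing \<open>p - 1\<close> and \<open>q - 1\<close>.
\<close>
definition ext_pFq ::
  "(complex \<Rightarrow> complex) \<Rightarrow> nat \<Rightarrow> nat \<Rightarrow> (nat \<Rightarrow> complex) \<Rightarrow> (nat \<Rightarrow> complex) \<Rightarrow>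
   complex \<Rightarrow> complex \<Rightarrow> complex \<Rightarrow> complex" where
  "ext_pFq \<Theta> p q \<alpha> \<beta> z b d =
     (if p = q + 1 then
        (\<Sum>m. pochhammer (\<alpha> 1) m *
           (\<Prod>j=1..q. ext_Beta \<Theta> b d (\<alpha> (j + 1) + of_nat m) (\<beta> j - \<alpha> (j + 1)) /
                      Beta (\<alpha> (j + 1)) (\<beta> j - \<alpha> (j + 1))) * (z ^ m / fact m))
      else if p = q then
        (\<Sum>m. (\<Prod>j=1..q. ext_Beta \<Theta> b d (\<alpha> j + of_nat m) (\<beta> j - \<alpha> j) /
                      Beta (\<alpha> j) (\<beta> j - \<alpha> j)) * (z ^ m / fact m))
      else let r = q - p in
        (\<Sum>m. 1 / (\<Prod>i=1..r. pochhammer (\<beta> i) m) *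
           (\<Prod>j=1..p. ext_Beta \<Theta> b d (\<alpha> j + of_nat m) (\<beta> (r + j) - \<alpha> j) /
                      Beta (\<alpha> j) (\<beta> (r + j) - \<alpha> j)) * (z ^ m / fact m)))"

definition ext_pFq_params ::
  "nat \<Rightarrow> nat \<Rightarrow> (nat \<Rightarrow> complex) \<Rightarrow> (nat \<Rightarrow> complex) \<Rightarrow> bool" where
  "ext_pFq_params p q \<alpha> \<beta> \<longleftrightarrow>
     (p = q + 1 \<and> (\<forall>j\<in>{1..q}. Re (\<beta> j) > Re (\<alpha> (j + 1)) \<and> Re (\<alpha> (j + 1)) > 0)) \<or>
     (p = q \<and> (\<forall>j\<in>{1..q}. Re (\<beta> j) > Re (\<alpha> j) \<and> Re (\<alpha> j) > 0)) \<or>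
     (p < q \<and> (\<forall>j\<in>{1..p}. Re (\<beta> (q - p + j)) > Re (\<alpha> j) \<and> Re (\<alpha> j) > 0) \<and>
        (\<forall>i\<in>{1..q - p}. \<beta> i \<notin> \<int>\<^sub>\<le>\<^sub>0))"

definition ext_pFq_defined ::
  "nat \<Rightarrow> nat \<Rightarrow> (nat \<Rightarrow> complex) \<Rightarrow> (nat \<Rightarrow> complex) \<Rightarrow> complex \<Rightarrow> bool" where
  "ext_pFq_defined p q \<alpha> \<beta> z \<longleftrightarrow> ext_pFq_params p q \<alpha> \<beta> \<and> (p = q + 1 \<longrightarrow> norm z < 1)"

text \<open>The library sets \<open>Arg 0 = 0\<close>, so \<open>z = 1\<close> has to be excluded separately.\<close>
definition cut_plane :: "complex set" where
  "cut_plane = {z. z \<noteq> 1 \<and> \<bar>Arg (1 - z)\<bar> < pi}"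

text \<open>
  \<open>F\<close> is the analytic continuation of \<open>f\<close> from the unit disk to the plane cut along \<open>[1, \<infinity>)\<close>.
  The cut plane is connected, so \<open>F\<close> is determined there by \<open>f\<close>.
\<close>
definition continues_to_cut_plane ::
  "(complex \<Rightarrow> complex) \<Rightarrow> (complex \<Rightarrow> complex) \<Rightarrow> bool" where
  "continues_to_cut_plane f F \<longleftrightarrow>
     F holomorphic_on cut_plane \<and> (\<forall>z. norm z < 1 \<longrightarrow> F z = f z)"

end

theory Submission imports Defs begin

text \<open>
  Expanding the inner function in powers of \<open>z * t\<close> and integrating term by term produces the extra
  factor \<open>ext_Beta \<Theta> b d (\<alpha> p + m) (\<beta> q - \<alpha> p)\<close>; the exchange is justified because
  \<open>\<bar>t ^ m\<bar> \<le> 1\<close> bounds all these factors by a single constant.  For \<open>b = d = 0\<close> and \<open>p = q + 1\<close> the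
  same formula, read from right to left, defines the continuation to the cut plane by recursion on \<open>q\<close>,
  starting from \<open>(1 - z) powr (- \<alpha> 1)\<close>.
\<close>

section \<open>Termwise integration against an integrable weight\<close>

lemma set_integrable_bounded_mult:
  fixes a g :: "real \<Rightarrow> complex"
  assumes g: "set_integrable lborel S g" and S: "S \<in> sets borel"
    and cont: "continuous_on S a" and bound: "\<And>t. t \<in> S \<Longrightarrow> norm (a t) \<le> B"
  shows "set_integrable lborel S (\<lambda>t. a t * g t)"
    and "(LINT t:S|lborel. norm (a t * g t)) \<le> B * (LINT t:S|lborel. norm (g t))"
proof -
  have ma: "(\<lambda>t. indicator S t *\<^sub>R a t) \<in> borel_measurable borel"
    using borel_measurable_continuous_on_indicator[OF S cont] .
  have ig: "integrable lborel (\<lambda>t. indicator S t *\<^sub>R g t)"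
    using g by (simp add: set_integrable_def)
  \<comment> \<open>Measurability is known only for the two functions cut off outside
    \<open>S\<close>, so each carries its own indicator; the indicator is idempotent.\<close>
  have "(\<lambda>t. (indicator S t *\<^sub>R a t) * (indicator S t *\<^sub>R g t)) \<in> borel_measurable lborel"
    using borel_measurable_integrable[OF ig] ma by (intro borel_measurable_times) simp_all
  moreover have "(\<lambda>t. (indicator S t *\<^sub>R a t) * (indicator S t *\<^sub>R g t))
      = (\<lambda>t. indicator S t *\<^sub>R (a t * g t))"
    by (auto simp: indicator_def)
  ultimately have m: "(\<lambda>t. indicator S t *\<^sub>R (a t * g t)) \<in> borel_measurable lborel" by simp
  have bd: "norm (indicator S t *\<^sub>R (a t * g t)) \<le> B * norm (indicator S t *\<^sub>R g t)" for t
    using bound[of t] by (auto simp: indicator_def norm_mult intro!: mult_right_mono)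
  have iB: "integrable lborel (\<lambda>t. B * norm (indicator S t *\<^sub>R g t))"
    using ig by (intro integrable_mult_right integrable_norm)
  have i: "integrable lborel (\<lambda>t. indicator S t *\<^sub>R (a t * g t))"
  proof (rule Bochner_Integration.integrable_bound[OF iB m])
    show "AE t in lborel. norm (indicator S t *\<^sub>R (a t * g t)) \<le> norm (B * norm (indicator S t *\<^sub>R g t))"
      using bd by (intro AE_I2) (metis abs_ge_self order_trans real_norm_def)
  qed
  then show "set_integrable lborel S (\<lambda>t. a t * g t)" by (simp add: set_integrable_def)
  have "(LINT t|lborel. norm (indicator S t *\<^sub>R (a t * g t))) \<le> (LINT t|lborel. B * norm (indicator S t *\<^sub>R g t))"
    by (rule integral_mono[OF integrable_norm[OF i] iB bd])
  then show "(LINT t:S|lborel. norm (a t * g t)) \<le> B * (LINT t:S|lborel. norm (g t))"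
    by (simp add: set_lebesgue_integral_def)
qed

text \<open>The integral of the norm of the \<open>n\<close>-th term is at most \<open>B n\<close>
  times that of \<open>norm (g t)\<close>, so these integrals are summable and sum and integral may
  be exchanged. Only the factors \<open>a n\<close> are bounded; the weight \<open>g\<close> may be
  unbounded, as beta integrands can be near the endpoints.\<close>

lemma set_integral_dominated_series:
  fixes a :: "nat \<Rightarrow> real \<Rightarrow> complex" and g :: "real \<Rightarrow> complex"
  assumes g: "set_integrable lborel S g" and S: "S \<in> sets borel"
    and cont: "\<And>n. continuous_on S (a n)"
    and bound: "\<And>n t. t \<in> S \<Longrightarrow> norm (a n t) \<le> B n" and B: "summable B"
  shows "set_integrable lborel S (\<lambda>t. (\<Sum>n. a n t) * g t)"
    and "(\<lambda>n. LINT t:S|lborel. a n t * g t) sums (LINT t:S|lborel. (\<Sum>n. a n t) * g t)"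
proof -
  let ?f = "\<lambda>n t. indicator S t *\<^sub>R (a n t * g t)"
  have i: "integrable lborel (?f n)" for n
    using set_integrable_bounded_mult(1)[OF g S cont bound] by (simp add: set_integrable_def)
  have sa: "summable (\<lambda>n. norm (a n t))" if "t \<in> S" for t
    using bound[OF that] by (intro summable_comparison_test'[OF B]) auto
  have sm: "AE t in lborel. summable (\<lambda>n. norm (?f n t))"
  proof (intro AE_I2)
    fix t show "summable (\<lambda>n. norm (?f n t))"
      by (cases "t \<in> S") (auto simp: norm_mult intro: summable_mult2 sa)
  qed
  have si: "summable (\<lambda>n. LINT t|lborel. norm (?f n t))"
  proof (rule summable_comparison_test')
    show "summable (\<lambda>n. B n * (LINT t:S|lborel. norm (g t)))" using B by (rule summable_mult2)
    fix n :: nat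
    show "norm (LINT t|lborel. norm (?f n t)) \<le> B n * (LINT t:S|lborel. norm (g t))"
      using set_integrable_bounded_mult(2)[OF g S cont bound, of n]
      by (simp add: set_lebesgue_integral_def)
  qed
  have eq: "(\<lambda>t. \<Sum>n. ?f n t) = (\<lambda>t. indicator S t *\<^sub>R ((\<Sum>n. a n t) * g t))"
  proof
    fix t show "(\<Sum>n. ?f n t) = indicator S t *\<^sub>R ((\<Sum>n. a n t) * g t)"
      by (cases "t \<in> S") (auto simp: suminf_mult2[OF summable_norm_cancel[OF sa]])
  qed
  from integrable_suminf[OF i sm si] show "set_integrable lborel S (\<lambda>t. (\<Sum>n. a n t) * g t)"
    unfolding eq set_integrable_def .
  from sums_integral[OF i sm si]
  show "(\<lambda>n. LINT t:S|lborel. a n t * g t) sums (LINT t:S|lborel. (\<Sum>n. a n t) * g t)"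
    unfolding eq set_lebesgue_integral_def .
qed

section \<open>Extended beta integrals with shifted first argument\<close>

lemma ext_beta_integrand_add_of_nat:
  assumes "t \<in> {0<..<1}"
  shows "ext_beta_integrand \<Theta> b d (x + of_nat m) y t = of_real t ^ m * ext_beta_integrand \<Theta> b d x y t"
proof -
  have "complex_of_real t powr (x + of_nat m - 1) = of_real t powr (x - 1) * of_real t powr (of_nat m)"
    by (simp flip: powr_add add: algebra_simps)
  \<comment> \<open>This uses \<open>t > 0\<close>: since \<open>0 powr 0 = 0\<close> but
    \<open>0 ^ 0 = 1\<close>, the case \<open>m = 0\<close> would fail at
    \<open>t = 0\<close>.\<close>
  also have "of_real t powr (of_nat m :: complex) = of_real t ^ m"
    using assms by (simp add: powr_nat')
  finally show ?thesis by (simp add: ext_beta_integrand_def mult_ac)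
qed

lemma ext_Beta_add_of_nat:
  "ext_Beta \<Theta> b d (x + of_nat m) y =
     (LBINT t:{0<..<1}. of_real t ^ m * ext_beta_integrand \<Theta> b d x y t)"
  unfolding ext_Beta_def
  by (intro set_lebesgue_integral_cong) (auto simp: ext_beta_integrand_add_of_nat)

text \<open>The shift only multiplies the integrand by \<open>t ^ m\<close>, of modulus at most 1.
  The bound is free of \<open>m\<close>, which later makes each beta ratio a bounded factor of the
  series.\<close>

lemma norm_ext_Beta_add_of_nat_le:
  assumes "set_integrable lborel {0<..<1} (ext_beta_integrand \<Theta> b d x y)"
  shows "norm (ext_Beta \<Theta> b d (x + of_nat m) y)
           \<le> (LBINT t:{0<..<1}. norm (ext_beta_integrand \<Theta> b d x y t))"
proof -
  let ?f = "\<lambda>t. of_real t ^ m * ext_beta_integrand \<Theta> b d x y t"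
  have bd: "norm (complex_of_real t ^ m) \<le> 1" if "t \<in> {0<..<1}" for t
    using that by (auto simp: norm_power intro: power_le_one)
  have c: "continuous_on {0<..<1} (\<lambda>t. complex_of_real t ^ m)" by (intro continuous_intros)
  note b = set_integrable_bounded_mult[OF assms _ c bd]
  have "norm (ext_Beta \<Theta> b d (x + of_nat m) y) \<le> (LBINT t:{0<..<1}. norm (?f t))"
    unfolding ext_Beta_add_of_nat using b(1) by (intro set_integral_norm_bound) auto
  also have "\<dots> \<le> (LBINT t:{0<..<1}. norm (ext_beta_integrand \<Theta> b d x y t))"
    using b(2) by simp
  finally show ?thesis .
qed

section \<open>Series coefficients and their recursion\<close>

text \<open>This is the factor of \<open>z ^ m / fact m\<close> in \<open>ext_pFq\<close>.
  Separating it lets the recursion in \<open>p\<close> and \<open>q\<close> be stated termwise,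
  where convergence is no issue.\<close>

definition ext_coeff ::
  "(complex \<Rightarrow> complex) \<Rightarrow> nat \<Rightarrow> nat \<Rightarrow> (nat \<Rightarrow> complex) \<Rightarrow> (nat \<Rightarrow> complex) \<Rightarrow>
   complex \<Rightarrow> complex \<Rightarrow> nat \<Rightarrow> complex" where
  "ext_coeff \<Theta> p q \<alpha> \<beta> b d m =
     (if p = q + 1 then
        pochhammer (\<alpha> 1) m *
          (\<Prod>j=1..q. ext_Beta \<Theta> b d (\<alpha> (j + 1) + of_nat m) (\<beta> j - \<alpha> (j + 1)) /
                     Beta (\<alpha> (j + 1)) (\<beta> j - \<alpha> (j + 1)))
      else if p = q then
        (\<Prod>j=1..q. ext_Beta \<Theta> b d (\<alpha> j + of_nat m) (\<beta> j - \<alpha> j) / Beta (\<alpha> j) (\<beta> j - \<alpha> j))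
      else let r = q - p in
        1 / (\<Prod>i=1..r. pochhammer (\<beta> i) m) *
          (\<Prod>j=1..p. ext_Beta \<Theta> b d (\<alpha> j + of_nat m) (\<beta> (r + j) - \<alpha> j) /
                     Beta (\<alpha> j) (\<beta> (r + j) - \<alpha> j)))"

lemma ext_pFq_eq_suminf:
  "ext_pFq \<Theta> p q \<alpha> \<beta> z b d = (\<Sum>m. ext_coeff \<Theta> p q \<alpha> \<beta> b d m * (z ^ m / fact m))"
  by (simp add: ext_pFq_def ext_coeff_def Let_def)

text \<open>Raising \<open>p\<close> and \<open>q\<close> together preserves \<open>q - p\<close>,
  hence the branch of the definition and its Pochhammer symbols; only the last factor of the beta
  product is new.\<close>

lemma ext_coeff_Suc:
  assumes "p \<le> q + 1"
  shows "ext_coeff \<Theta> (Suc p) (Suc q) \<alpha> \<beta> b d m = ext_coeff \<Theta> p q \<alpha> \<beta> b d m *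
     (ext_Beta \<Theta> b d (\<alpha> (Suc p) + of_nat m) (\<beta> (Suc q) - \<alpha> (Suc p)) /
      Beta (\<alpha> (Suc p)) (\<beta> (Suc q) - \<alpha> (Suc p)))"
  using assms unfolding ext_coeff_def Let_def by (auto simp: prod.nat_ivl_Suc')

lemma ext_pFq_params_Suc:
  assumes "p \<le> q + 1"
  shows "ext_pFq_params (Suc p) (Suc q) \<alpha> \<beta> \<longleftrightarrow>
     ext_pFq_params p q \<alpha> \<beta> \<and> Re (\<beta> (Suc q)) > Re (\<alpha> (Suc p)) \<and> Re (\<alpha> (Suc p)) > 0"
proof -
  consider "p = q + 1" | "p = q" | "p < q" using assms by linarith
  then show ?thesis
    by cases (auto simp: ext_pFq_params_def atLeastAtMostSuc_conv)
qed

section \<open>Growth of the coefficients and absolute convergence\<close>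

text \<open>Up to sign these are the terms of the binomial series with exponent
  \<open>- a\<close>.\<close>

lemma summable_norm_pochhammer_power:
  fixes z :: complex
  assumes "norm z < 1"
  shows "summable (\<lambda>m. norm (pochhammer a m * (z ^ m / fact m)))"
proof -
  \<comment> \<open>Convergence at a real point strictly between \<open>norm z\<close> and 1 gives
    absolute convergence at \<open>z\<close>.\<close>
  obtain r where r: "norm z < r" "r < 1" using dense[OF assms] by auto
  have "summable (\<lambda>n. ((- a) gchoose n) * (of_real r :: complex) ^ n)"
    by (rule sums_summable[OF gen_binomial_complex]) (use r order_le_less_trans[OF norm_ge_zero r(1)] in auto)
  from powser_insidea[OF this, of z]
  have "summable (\<lambda>n. norm (((- a) gchoose n) * z ^ n))"
    using r norm_ge_zero[of z] by simp
  then show ?thesis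
    by (simp add: gbinomial_pochhammer norm_mult norm_power norm_divide)
qed

text \<open>From some index \<open>N\<close> on, each new factor \<open>c + m\<close> has modulus at
  least 1, so the reciprocals stop growing.\<close>

lemma norm_inverse_pochhammer_bounded:
  fixes c :: complex
  assumes "c \<notin> \<int>\<^sub>\<le>\<^sub>0"
  shows "\<exists>C. \<forall>m. norm (1 / pochhammer c m) \<le> C"
proof -
  obtain N :: nat where N: "real N \<ge> norm c + 1" using real_arch_simple by blast
  have dec: "norm (1 / pochhammer c (N + k)) \<le> norm (1 / pochhammer c N)" for k
  proof (induction k)
    case (Suc k)
    have "real (N + k) = norm ((c + of_nat (N + k)) - c)" by (simp del: of_nat_add)
    also have "\<dots> \<le> norm (c + of_nat (N + k)) + norm c" by (rule norm_triangle_ineq4)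
    finally have "1 \<le> norm (c + of_nat (N + k))" using N by (simp del: of_nat_add)
    then have "norm (1 / pochhammer c (N + Suc k)) \<le> norm (1 / pochhammer c (N + k))"
      by (auto simp: pochhammer_Suc norm_mult norm_divide divide_simps mult_le_cancel_left1)
    with Suc show ?case by linarith
  qed simp
  \<comment> \<open>The summands are nonnegative, so the sum dominates every early value, including
    the one at \<open>N\<close> that bounds all later ones.\<close>
  have "norm (1 / pochhammer c m) \<le> (\<Sum>k\<le>N. norm (1 / pochhammer c k))" for m
  proof (cases "m \<le> N")
    case False
    then have "norm (1 / pochhammer c m) \<le> norm (1 / pochhammer c N)"
      using dec[of "m - N"] by simp
    also have "\<dots> \<le> (\<Sum>k\<le>N. norm (1 / pochhammer c k))" by (rule member_le_sum) auto
    finally show ?thesis .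
  qed (auto intro: member_le_sum)
  then show ?thesis by blast
qed

lemma prod_norm_bounded:
  fixes f :: "'a \<Rightarrow> 'b \<Rightarrow> complex"
  assumes "\<And>i. i \<in> A \<Longrightarrow> \<exists>C. \<forall>m. norm (f i m) \<le> C"
  shows "\<exists>C. \<forall>m. norm (\<Prod>i\<in>A. f i m) \<le> C"
proof -
  obtain C where "\<And>i m. i \<in> A \<Longrightarrow> norm (f i m) \<le> C i" using assms by metis
  then have "norm (\<Prod>i\<in>A. f i m) \<le> (\<Prod>i\<in>A. C i)" for m
    by (simp add: prod_norm[symmetric] prod_mono)
  then show ?thesis by blast
qed

text \<open>Beta ratios and reciprocal Pochhammer symbols are bounded in \<open>m\<close>; what can
  grow is \<open>pochhammer (\<alpha> 1) m\<close>, present when \<open>p = q + 1\<close>. The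
  comparison series is binomial in that case and exponential otherwise.\<close>

lemma summable_norm_ext_coeff_power:
  assumes int: "\<And>x y. Re x > 0 \<Longrightarrow> Re y > 0 \<Longrightarrow>
      set_integrable lborel {0<..<1} (ext_beta_integrand \<Theta> b d x y)"
    and "ext_pFq_defined p q \<alpha> \<beta> z"
  shows "summable (\<lambda>m. norm (ext_coeff \<Theta> p q \<alpha> \<beta> b d m * (z ^ m / fact m)))"
proof -
  have par: "ext_pFq_params p q \<alpha> \<beta>" and z: "p = q + 1 \<Longrightarrow> norm z < 1"
    using assms(2) by (auto simp: ext_pFq_defined_def)
  have ratio: "\<exists>C. \<forall>m. norm (ext_Beta \<Theta> b d (x + of_nat m) (y - x) / Beta x (y - x)) \<le> C"
    if "Re x > 0" "Re y > Re x" for x y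
  proof -
    have "norm (ext_Beta \<Theta> b d (x + of_nat m) (y - x) / Beta x (y - x))
        \<le> (LBINT t:{0<..<1}. norm (ext_beta_integrand \<Theta> b d x (y - x) t)) / norm (Beta x (y - x))" for m
      unfolding norm_divide using that
      by (intro divide_right_mono norm_ext_Beta_add_of_nat_le int) auto
    then show ?thesis by blast
  qed
  define w where "w m = (if p = q + 1 then pochhammer (\<alpha> 1) m else 1)" for m
  have "\<exists>C. \<forall>m. norm (ext_coeff \<Theta> p q \<alpha> \<beta> b d m) \<le> norm (w m) * C"
  proof -
    consider "p = q + 1" | "p = q" | "p < q" using par by (auto simp: ext_pFq_params_def)
    then show ?thesis
    proof cases
      case 1
      then have "\<exists>C. \<forall>m. norm (\<Prod>j=1..q. ext_Beta \<Theta> b d (\<alpha> (j + 1) + of_nat m) (\<beta> j - \<alpha> (j + 1)) /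
                     Beta (\<alpha> (j + 1)) (\<beta> j - \<alpha> (j + 1))) \<le> C"
        using par by (intro prod_norm_bounded ratio) (auto simp: ext_pFq_params_def)
      then obtain C where "\<And>m. norm (\<Prod>j=1..q. ext_Beta \<Theta> b d (\<alpha> (j + 1) + of_nat m) (\<beta> j - \<alpha> (j + 1)) /
                     Beta (\<alpha> (j + 1)) (\<beta> j - \<alpha> (j + 1))) \<le> C" by blast
      then show ?thesis using 1
        by (intro exI[of _ C] allI) (simp add: w_def ext_coeff_def norm_mult mult_left_mono)
    next
      case 2
      then have "\<exists>C. \<forall>m. norm (\<Prod>j=1..q. ext_Beta \<Theta> b d (\<alpha> j + of_nat m) (\<beta> j - \<alpha> j) /
                     Beta (\<alpha> j) (\<beta> j - \<alpha> j)) \<le> C"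
        using par by (intro prod_norm_bounded ratio) (auto simp: ext_pFq_params_def)
      then show ?thesis using 2 by (simp add: w_def ext_coeff_def)
    next
      case 3
      then have "\<exists>C. \<forall>m. norm (\<Prod>j=1..p. ext_Beta \<Theta> b d (\<alpha> j + of_nat m) (\<beta> (q - p + j) - \<alpha> j) /
                     Beta (\<alpha> j) (\<beta> (q - p + j) - \<alpha> j)) \<le> C"
        using par by (intro prod_norm_bounded ratio) (auto simp: ext_pFq_params_def)
      then obtain C where C: "\<And>m. norm (\<Prod>j=1..p. ext_Beta \<Theta> b d (\<alpha> j + of_nat m) (\<beta> (q - p + j) - \<alpha> j) /
                     Beta (\<alpha> j) (\<beta> (q - p + j) - \<alpha> j)) \<le> C" by blast
      have "\<exists>D. \<forall>m. norm (\<Prod>i=1..q - p. 1 / pochhammer (\<beta> i) m) \<le> D"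
        using par 3
        by (intro prod_norm_bounded norm_inverse_pochhammer_bounded) (auto simp: ext_pFq_params_def)
      then obtain D where D: "\<And>m. norm (\<Prod>i=1..q - p. 1 / pochhammer (\<beta> i) m) \<le> D" by blast
      \<comment> \<open>The sign is needed to multiply the two bounds; any single index reveals
        it.\<close>
      have "0 \<le> D" using norm_ge_zero D[of 0] by (rule order_trans)
      have "norm (ext_coeff \<Theta> p q \<alpha> \<beta> b d m) \<le> D * C" for m
      proof -
        have "ext_coeff \<Theta> p q \<alpha> \<beta> b d m = (\<Prod>i=1..q - p. 1 / pochhammer (\<beta> i) m) *
            (\<Prod>j=1..p. ext_Beta \<Theta> b d (\<alpha> j + of_nat m) (\<beta> (q - p + j) - \<alpha> j) /
                     Beta (\<alpha> j) (\<beta> (q - p + j) - \<alpha> j))"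
          using 3 by (simp add: ext_coeff_def prod_dividef)
        then show ?thesis
          using mult_mono[OF D C \<open>0 \<le> D\<close> norm_ge_zero] by (simp only: norm_mult)
      qed
      then show ?thesis using 3 by (auto simp: w_def)
    qed
  qed
  then obtain C where C: "\<And>m. norm (ext_coeff \<Theta> p q \<alpha> \<beta> b d m) \<le> norm (w m) * C" by blast
  have sw: "summable (\<lambda>m. norm (w m * (z ^ m / fact m)))"
  proof (cases "p = q + 1")
    case True
    then show ?thesis using summable_norm_pochhammer_power[OF z] by (simp add: w_def)
  next
    case False
    then show ?thesis using summable_norm_exp[of z]
      by (simp add: w_def norm_divide norm_power field_simps scaleR_conv_of_real)
  qed
  show ?thesis
  proof (rule summable_comparison_test')
    show "summable (\<lambda>m. norm (w m * (z ^ m / fact m)) * C)" using sw by (rule summable_mult2)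
    fix m :: nat
    show "norm (norm (ext_coeff \<Theta> p q \<alpha> \<beta> b d m * (z ^ m / fact m)))
            \<le> norm (w m * (z ^ m / fact m)) * C"
      using mult_right_mono[OF C[of m], of "norm (z ^ m / fact m)"]
      by (simp only: norm_mult mult_ac real_norm_def abs_mult abs_norm_cancel norm_ge_zero)
  qed
qed

section \<open>The integral formula by termwise integration\<close>

text \<open>Integrability is assumed at the given \<open>b\<close> and \<open>d\<close> only, so one
  statement serves both positive real parts and \<open>b = d = 0\<close>.\<close>

lemma ext_pFq_Suc_integral:
  assumes int: "\<And>x y. Re x > 0 \<Longrightarrow> Re y > 0 \<Longrightarrow>
      set_integrable lborel {0<..<1} (ext_beta_integrand \<Theta> b d x y)"
    and pq: "p \<le> q + 1" and "ext_pFq_defined (Suc p) (Suc q) \<alpha> \<beta> z"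
  defines "x \<equiv> \<alpha> (Suc p)" and "y \<equiv> \<beta> (Suc q) - \<alpha> (Suc p)"
  shows "set_integrable lborel {0<..<1}
           (\<lambda>t. ext_pFq \<Theta> p q \<alpha> \<beta> (z * of_real t) b d * ext_beta_integrand \<Theta> b d x y t)"
    and "ext_pFq \<Theta> (Suc p) (Suc q) \<alpha> \<beta> z b d =
           (LBINT t:{0<..<1}. ext_pFq \<Theta> p q \<alpha> \<beta> (z * of_real t) b d * ext_beta_integrand \<Theta> b d x y t)
             / Beta x y"
proof -
  let ?c = "ext_coeff \<Theta> p q \<alpha> \<beta> b d"
  let ?a = "\<lambda>m t. ?c m * ((z * of_real t) ^ m / fact m)"
  let ?g = "ext_beta_integrand \<Theta> b d x y"
  have def: "ext_pFq_defined p q \<alpha> \<beta> z"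
    and g: "set_integrable lborel {0<..<1} ?g"
    using assms(3) pq by (auto simp: ext_pFq_defined_def ext_pFq_params_Suc x_def y_def intro!: int)
  have cont: "continuous_on {0<..<1} (?a m)" for m by (intro continuous_intros) auto
  \<comment> \<open>As \<open>0 < t < 1\<close>, the terms at \<open>z * t\<close> are dominated by
    those at \<open>z\<close>, whose absolute convergence supplies a bound uniform in
    \<open>t\<close>.\<close>
  have bd: "norm (?a m t) \<le> norm (?c m * (z ^ m / fact m))" if "t \<in> {0<..<1}" for m t
  proof -
    have "norm (?a m t) = norm (?c m * (z ^ m / fact m)) * t ^ m"
      using that by (simp add: norm_mult norm_power norm_divide power_mult_distrib)
    also have "\<dots> \<le> norm (?c m * (z ^ m / fact m)) * 1"
      using that by (intro mult_left_mono power_le_one) auto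
    finally show ?thesis by simp
  qed
  note exch = set_integral_dominated_series[OF g _ cont bd
      summable_norm_ext_coeff_power[OF int def], simplified]
  show "set_integrable lborel {0<..<1} (\<lambda>t. ext_pFq \<Theta> p q \<alpha> \<beta> (z * of_real t) b d * ?g t)"
    using exch(1) by (simp add: ext_pFq_eq_suminf)
  let ?I = "LBINT t:{0<..<1}. ext_pFq \<Theta> p q \<alpha> \<beta> (z * of_real t) b d * ?g t"
  have term_eq: "(LBINT t:{0<..<1}. ?a m t * ?g t) = ?c m * (z ^ m / fact m) * ext_Beta \<Theta> b d (x + of_nat m) y" for m
    unfolding ext_Beta_add_of_nat set_integral_mult_right[symmetric]
    by (simp add: power_mult_distrib mult_ac)
  have "(\<lambda>m. ?c m * (z ^ m / fact m) * ext_Beta \<Theta> b d (x + of_nat m) y) sums ?I"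
    using exch(2) unfolding term_eq[symmetric] ext_pFq_eq_suminf by simp
  \<comment> \<open>Division by \<open>Beta x y\<close> turns the shifted beta value into the new
    last factor of \<open>ext_coeff_Suc\<close>.\<close>
  from sums_divide[OF this, of "Beta x y"]
  have "(\<lambda>m. ext_coeff \<Theta> (Suc p) (Suc q) \<alpha> \<beta> b d m * (z ^ m / fact m)) sums (?I / Beta x y)"
    using pq by (simp add: ext_coeff_Suc x_def y_def mult_ac)
  then show "ext_pFq \<Theta> (Suc p) (Suc q) \<alpha> \<beta> z b d = ?I / Beta x y"
    by (simp add: ext_pFq_eq_suminf sums_iff)
qed

section \<open>The cut plane and integrals over dilations\<close>

text \<open>As \<open>Arg\<close> takes values in \<open>(-pi, pi]\<close>, the bound excludes just
  \<open>Arg = pi\<close>, that is negative real \<open>1 - z\<close>, while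
  \<open>z \<noteq> 1\<close> excludes 0. In this form openness and holomorphy of principal powers
  are immediate.\<close>

lemma cut_plane_eq: "cut_plane = {z. 1 - z \<notin> \<real>\<^sub>\<le>\<^sub>0}"
proof -
  have "\<bar>Arg w\<bar> < pi \<longleftrightarrow> Arg w \<noteq> pi" for w
    using Arg_bounded[of w] by (auto simp: abs_if)
  then show ?thesis
    by (auto simp: cut_plane_def Arg_eq_pi complex_nonpos_Reals_iff complex_eq_iff)
qed

lemma open_cut_plane: "open cut_plane"
proof -
  have "cut_plane = (\<lambda>z. 1 - z) -` (- \<real>\<^sub>\<le>\<^sub>0)" by (auto simp: cut_plane_eq)
  moreover have "open \<dots>"
    by (intro continuous_open_vimage continuous_intros) (auto simp: open_Compl)
  ultimately show ?thesis by simp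
qed

text \<open>Dividing a point of the cut by some \<open>t\<close> in \<open>(0, 1]\<close> moves it
  outwards along the cut, and 0 is off the cut. So the cut plane is star-shaped about 0.\<close>

lemma mult_of_real_in_cut_plane:
  assumes "z \<in> cut_plane" "t \<in> {0..1}"
  shows "z * of_real t \<in> cut_plane"
proof (rule ccontr)
  assume "z * of_real t \<notin> cut_plane"
  then have *: "Im z * t = 0" "1 \<le> Re z * t"
    by (auto simp: cut_plane_eq complex_nonpos_Reals_iff)
  then have "t \<noteq> 0" by auto
  with * have "Im z = 0" by simp
  moreover have "1 \<le> Re z"
  proof (rule ccontr)
    assume "\<not> 1 \<le> Re z"
    then have "Re z * t < 1 * t" using \<open>t \<noteq> 0\<close> assms by (intro mult_strict_right_mono) auto
    with * assms show False by auto
  qed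
  ultimately show False using assms by (simp add: cut_plane_eq complex_nonpos_Reals_iff)
qed

text \<open>
  Around each point the integrand is a power series whose coefficients are bounded uniformly in \<open>t\<close> by
  Cauchy's inequality, so the integral is again a power series.
\<close>
lemma holomorphic_on_dilation_integral:
  fixes g :: "real \<Rightarrow> complex" and G :: "complex \<Rightarrow> complex"
  assumes g: "set_integrable lborel {0<..<1} g" and G: "G holomorphic_on U" and U: "open U"
    and star: "\<And>z t. z \<in> U \<Longrightarrow> t \<in> {0..1} \<Longrightarrow> z * of_real t \<in> U"
  shows "z \<in> U \<Longrightarrow> set_integrable lborel {0<..<1} (\<lambda>t. G (z * of_real t) * g t)"
    and "(\<lambda>z. LBINT t:{0<..<1}. G (z * of_real t) * g t) holomorphic_on U"
proof -
  have local_series: "\<exists>r>0. \<exists>c. \<forall>w\<in>ball z r.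
      set_integrable lborel {0<..<1} (\<lambda>t. G (w * of_real t) * g t) \<and>
      (\<lambda>n. c n * (w - z) ^ n) sums (LBINT t:{0<..<1}. G (w * of_real t) * g t)"
    if "z \<in> U" for z
  proof -
    obtain r where r: "r > 0" "cball z r \<subseteq> U" using U \<open>z \<in> U\<close> open_contains_cball by blast
    \<comment> \<open>The dilates of the closed disk form a compact set, which gives a bound
      \<open>M\<close> for \<open>G\<close> independent of \<open>t\<close>. The parameter interval
      is closed for the sake of compactness.\<close>
    define K where "K = (\<lambda>(w, t). w * complex_of_real t) ` (cball z r \<times> {0..1})"
    have "compact K" unfolding K_def case_prod_unfold
      by (intro compact_continuous_image compact_Times continuous_intros) auto
    moreover have "K \<subseteq> U" using r star by (auto simp: K_def)
    ultimately have "bounded (G ` K)"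
      using holomorphic_on_imp_continuous_on[OF G]
      by (meson compact_continuous_image compact_imp_bounded continuous_on_subset)
    then obtain M where M: "\<And>w t. w \<in> cball z r \<Longrightarrow> t \<in> {0..1} \<Longrightarrow> norm (G (w * of_real t)) \<le> M"
      by (fastforce simp: bounded_iff K_def)
    \<comment> \<open>This is the \<open>n\<close>-th Taylor coefficient at \<open>z\<close> of the
      map taking \<open>w\<close> to \<open>G (w * t)\<close>. Written through derivatives of
      \<open>G\<close> it is visibly continuous in \<open>t\<close>; \<open>D_eq\<close> recovers
      the form to which Cauchy's inequality applies.\<close>
    define D where "D n t = (deriv ^^ n) G (z * of_real t) * of_real t ^ n / fact n" for n t
    have hol: "(\<lambda>w. G (w * of_real t)) holomorphic_on cball z r" if "t \<in> {0..1}" for t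
    proof -
      have "(\<lambda>w. w * of_real t) ` cball z r \<subseteq> U" using r star that by blast
      then have "G \<circ> (\<lambda>w. w * of_real t) holomorphic_on cball z r"
        using G by (intro holomorphic_on_compose_gen holomorphic_intros)
      then show ?thesis by (simp add: o_def)
    qed
    have D_eq: "D n t = (deriv ^^ n) (\<lambda>w. G (w * of_real t)) z / fact n" if "t \<in> {0..1}" for n t
      using higher_deriv_compose_linear[of G U U z "of_real t" n] G U \<open>z \<in> U\<close> star that
      by (simp add: D_def mult.commute)
    have D_bound: "norm (D n t) \<le> M / r ^ n" if "t \<in> {0..1}" for n t
    proof -
      have "norm ((deriv ^^ n) (\<lambda>w. G (w * of_real t)) z) \<le> fact n * M / r ^ n"
        using hol[OF that] M[OF _ that] r(1)
        by (intro Cauchy_inequality holomorphic_on_imp_continuous_on)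
           (auto intro: holomorphic_on_subset simp: dist_norm)
      then show ?thesis by (simp add: D_eq[OF that] norm_divide field_simps)
    qed
    have D_cont: "continuous_on {0<..<1} (D n)" for n
    proof -
      have "continuous_on U ((deriv ^^ n) G)"
        using holomorphic_on_imp_continuous_on holomorphic_higher_deriv[OF G U] by blast
      then have "continuous_on {0<..<1} (\<lambda>t. (deriv ^^ n) G (z * of_real t))"
        by (rule continuous_on_compose2)
           (use star \<open>z \<in> U\<close> in \<open>auto intro!: continuous_intros\<close>)
      then show ?thesis unfolding D_def by (intro continuous_intros) auto
    qed
    define c where "c n = (LBINT t:{0<..<1}. D n t * g t)" for n
    have "set_integrable lborel {0<..<1} (\<lambda>t. G (w * of_real t) * g t) \<and>
      (\<lambda>n. c n * (w - z) ^ n) sums (LBINT t:{0<..<1}. G (w * of_real t) * g t)"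
      if w: "w \<in> ball z r" for w
    proof -
      have cont: "continuous_on {0<..<1} (\<lambda>t. D n t * (w - z) ^ n)" for n
        by (intro continuous_intros D_cont)
      \<comment> \<open>The majorant is geometric with ratio \<open>norm (w - z) / r\<close>, which
        is below 1 in the open disk.\<close>
      have bd: "norm (D n t * (w - z) ^ n) \<le> M * (norm (w - z) / r) ^ n" if "t \<in> {0<..<1}" for n t
        using mult_right_mono[OF D_bound[of t n], of "norm (w - z) ^ n"] that
        by (simp add: norm_mult norm_power power_divide)
      have sm: "summable (\<lambda>n. M * (norm (w - z) / r) ^ n)"
        using w r by (intro summable_mult summable_geometric) (auto simp: dist_norm norm_minus_commute)
      have G_eq: "(\<Sum>n. D n t * (w - z) ^ n) = G (w * of_real t)" if "t \<in> {0<..<1}" for t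
        using holomorphic_power_series[of "\<lambda>w. G (w * of_real t)" z r w] w that
          holomorphic_on_subset[OF hol[of t] ball_subset_cball]
        by (simp add: D_eq sums_iff)
      note exch = set_integral_dominated_series[OF g _ cont bd sm, simplified]
      have "set_integrable lborel {0<..<1} (\<lambda>t. G (w * of_real t) * g t)"
        using exch(1) by (rule set_integrable_cong[THEN iffD1, rotated -1]) (auto simp: G_eq)
      moreover have "(LBINT t:{0<..<1}. (\<Sum>n. D n t * (w - z) ^ n) * g t)
          = (LBINT t:{0<..<1}. G (w * of_real t) * g t)"
        by (intro set_lebesgue_integral_cong) (auto simp: G_eq)
      moreover have "(LBINT t:{0<..<1}. D n t * (w - z) ^ n * g t) = c n * (w - z) ^ n" for n
        unfolding c_def set_integral_mult_left[symmetric] by (simp add: mult_ac)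
      ultimately show ?thesis using exch(2) by simp
    qed
    with r show ?thesis by blast
  qed
  show "set_integrable lborel {0<..<1} (\<lambda>t. G (z * of_real t) * g t)" if "z \<in> U"
    using local_series[OF that] by force
  show "(\<lambda>z. LBINT t:{0<..<1}. G (z * of_real t) * g t) holomorphic_on U"
    unfolding holomorphic_on_def
  proof
    fix z assume "z \<in> U"
    from local_series[OF this] obtain r c where "r > 0"
      and "\<And>w. w \<in> ball z r \<Longrightarrow> (\<lambda>n. c n * (w - z) ^ n) sums (LBINT t:{0<..<1}. G (w * of_real t) * g t)"
      by blast
    then have "(\<lambda>z. LBINT t:{0<..<1}. G (z * of_real t) * g t) holomorphic_on ball z r"
      by (intro power_series_holomorphic)
    with \<open>r > 0\<close> show "(\<lambda>z. LBINT t:{0<..<1}. G (z * of_real t) * g t) field_differentiable at z within U"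
      using holomorphic_on_imp_differentiable_at[of _ "ball z r" z]
      by (auto intro: field_differentiable_at_within)
  qed
qed

section \<open>Continuation to the cut plane for \<open>b = d = 0\<close>\<close>

text \<open>The integral of the lower continuation \<open>G\<close> is holomorphic as an integral
  over dilations, and in the unit disk the integral formula identifies it with the series.\<close>

lemma continues_to_cut_plane_Suc:
  assumes int: "\<And>x y. Re x > 0 \<Longrightarrow> Re y > 0 \<Longrightarrow>
      set_integrable lborel {0<..<1} (ext_beta_integrand \<Theta> 0 0 x y)"
    and params: "ext_pFq_params (Suc (Suc q)) (Suc q) \<alpha> \<beta>"
    and G: "continues_to_cut_plane (\<lambda>u. ext_pFq \<Theta> (Suc q) q \<alpha> \<beta> u 0 0) G"
  defines "x \<equiv> \<alpha> (Suc (Suc q))" and "y \<equiv> \<beta> (Suc q) - \<alpha> (Suc (Suc q))"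
  shows "z \<in> cut_plane \<Longrightarrow>
           set_integrable lborel {0<..<1} (\<lambda>t. G (z * of_real t) * ext_beta_integrand \<Theta> 0 0 x y t)"
    and "continues_to_cut_plane (\<lambda>u. ext_pFq \<Theta> (Suc (Suc q)) (Suc q) \<alpha> \<beta> u 0 0)
           (\<lambda>z. (LBINT t:{0<..<1}. G (z * of_real t) * ext_beta_integrand \<Theta> 0 0 x y t) / Beta x y)"
proof -
  let ?g = "ext_beta_integrand \<Theta> 0 0 x y"
  have g: "set_integrable lborel {0<..<1} ?g"
    using params by (intro int) (auto simp: ext_pFq_params_Suc x_def y_def)
  have holG: "G holomorphic_on cut_plane"
    and G_eq: "\<And>z. norm z < 1 \<Longrightarrow> G z = ext_pFq \<Theta> (Suc q) q \<alpha> \<beta> z 0 0"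
    using G by (auto simp: continues_to_cut_plane_def)
  note dil = holomorphic_on_dilation_integral[OF g holG open_cut_plane mult_of_real_in_cut_plane]
  show "z \<in> cut_plane \<Longrightarrow> set_integrable lborel {0<..<1} (\<lambda>t. G (z * of_real t) * ?g t)"
    using dil(1) by blast
  have hol: "(\<lambda>z. (LBINT t:{0<..<1}. G (z * of_real t) * ?g t) / Beta x y) holomorphic_on cut_plane"
    using dil(2) unfolding divide_inverse by (intro holomorphic_on_mult) auto
  have "(LBINT t:{0<..<1}. G (z * of_real t) * ?g t) / Beta x y
          = ext_pFq \<Theta> (Suc (Suc q)) (Suc q) \<alpha> \<beta> z 0 0" if z: "norm z < 1" for z
  proof -
    \<comment> \<open>The segment from 0 to \<open>z\<close> stays in the unit disk, so
      \<open>G\<close> may be replaced by the series it continues.\<close>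
    have "norm (z * of_real t) < 1" if "t \<in> {0<..<1}" for t
      using mult_strict_mono'[of "norm z" 1 t 1] z that by (auto simp: norm_mult)
    then have "(LBINT t:{0<..<1}. G (z * of_real t) * ?g t)
        = (LBINT t:{0<..<1}. ext_pFq \<Theta> (Suc q) q \<alpha> \<beta> (z * of_real t) 0 0 * ?g t)"
      by (intro set_lebesgue_integral_cong) (auto simp: G_eq)
    then show ?thesis
      using ext_pFq_Suc_integral(2)[OF int, of "Suc q" q \<alpha> \<beta> z] params z
      by (simp add: x_def y_def ext_pFq_defined_def)
  qed
  with hol show "continues_to_cut_plane (\<lambda>u. ext_pFq \<Theta> (Suc (Suc q)) (Suc q) \<alpha> \<beta> u 0 0)
      (\<lambda>z. (LBINT t:{0<..<1}. G (z * of_real t) * ?g t) / Beta x y)"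
    by (simp add: continues_to_cut_plane_def)
qed

lemma continues_to_cut_plane_exists:
  assumes int: "\<And>x y. Re x > 0 \<Longrightarrow> Re y > 0 \<Longrightarrow>
      set_integrable lborel {0<..<1} (ext_beta_integrand \<Theta> 0 0 x y)"
    and "ext_pFq_params (Suc q) q \<alpha> \<beta>"
  shows "\<exists>F. continues_to_cut_plane (\<lambda>u. ext_pFq \<Theta> (Suc q) q \<alpha> \<beta> u 0 0) F"
  using assms(2)
proof (induction q)
  case 0
  have "(1 - z) powr (- \<alpha> 1) = ext_pFq \<Theta> (Suc 0) 0 \<alpha> \<beta> z 0 0" if "norm z < 1" for z
  proof -
    have "(\<lambda>n. ((- \<alpha> 1) gchoose n) * (- z) ^ n) sums (1 - z) powr (- \<alpha> 1)"
      using gen_binomial_complex[of "- z" "- \<alpha> 1"] that by simp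
    \<comment> \<open>The sign from writing the binomial coefficient as a Pochhammer symbol cancels
      that of \<open>(- z) ^ n\<close>; for \<open>q = 0\<close> the beta product is empty.\<close>
    moreover have "((- \<alpha> 1) gchoose n) * (- z) ^ n = ext_coeff \<Theta> (Suc 0) 0 \<alpha> \<beta> 0 0 n * (z ^ n / fact n)" for n
    proof -
      have "(- 1) ^ n * (- z) ^ n = z ^ n" by (simp flip: power_mult_distrib)
      then show ?thesis by (simp add: gbinomial_pochhammer ext_coeff_def mult_ac)
    qed
    ultimately show ?thesis by (simp add: ext_pFq_eq_suminf sums_iff)
  qed
  moreover have "(\<lambda>z. (1 - z) powr (- \<alpha> 1)) holomorphic_on cut_plane"
    by (intro holomorphic_intros) (auto simp: cut_plane_eq)
  ultimately show ?case unfolding continues_to_cut_plane_def by blast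
next
  case (Suc q)
  have "ext_pFq_params (Suc q) q \<alpha> \<beta>"
    using Suc.prems by (auto simp: ext_pFq_params_Suc)
  then obtain G where G: "continues_to_cut_plane (\<lambda>u. ext_pFq \<Theta> (Suc q) q \<alpha> \<beta> u 0 0) G"
    using Suc.IH by blast
  show ?case
    using continues_to_cut_plane_Suc[OF int Suc.prems G] by auto
qed

section \<open>The formula for convergent series and for their continuations\<close>

theorem theorem2p1:
  fixes \<kappa> :: "nat \<Rightarrow> complex" and R M :: real and \<omega> :: complex
    and \<Theta> :: "complex \<Rightarrow> complex"
    and p q :: nat and \<alpha> \<beta> :: "nat \<Rightarrow> complex"
  assumes "ext_kernel \<kappa> R M \<omega> \<Theta>"
    and "p \<ge> 1" and "q \<ge> 1" and "p \<le> q + 1"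
    and "Re (\<beta> q) > Re (\<alpha> p)" and "Re (\<alpha> p) > 0"
    and "ext_pFq_params p q \<alpha> \<beta>"
  shows "(\<forall>b d z. ext_pFq_defined p q \<alpha> \<beta> z \<longrightarrow>
            (Re b > 0 \<and> Re d > 0) \<or> (b = 0 \<and> d = 0 \<and> \<bar>Arg (1 - z)\<bar> < pi) \<longrightarrow>
            set_integrable lborel {0<..<1} (\<lambda>t.
               of_real t powr (\<alpha> p - 1) * of_real (1 - t) powr (\<beta> q - \<alpha> p - 1) *
               ext_pFq \<Theta> (p - 1) (q - 1) \<alpha> \<beta> (z * of_real t) b d *
               \<Theta> (- (b / of_real t) - d / of_real (1 - t))) \<and>
            ext_pFq \<Theta> p q \<alpha> \<beta> z b d =
              Gamma (\<beta> q) / (Gamma (\<alpha> p) * Gamma (\<beta> q - \<alpha> p)) *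
              (LBINT t:{0<..<1}.
                 of_real t powr (\<alpha> p - 1) * of_real (1 - t) powr (\<beta> q - \<alpha> p - 1) *
                 ext_pFq \<Theta> (p - 1) (q - 1) \<alpha> \<beta> (z * of_real t) b d *
                 \<Theta> (- (b / of_real t) - d / of_real (1 - t)))) \<and>
         (p = q + 1 \<longrightarrow>
            (\<exists>F G. continues_to_cut_plane (\<lambda>u. ext_pFq \<Theta> p q \<alpha> \<beta> u 0 0) F \<and>
                   continues_to_cut_plane (\<lambda>u. ext_pFq \<Theta> (p - 1) (q - 1) \<alpha> \<beta> u 0 0) G \<and>
                   (\<forall>z\<in>cut_plane.
                      set_integrable lborel {0<..<1} (\<lambda>t.
                         of_real t powr (\<alpha> p - 1) * of_real (1 - t) powr (\<beta> q - \<alpha> p - 1) *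
                         G (z * of_real t) * \<Theta> 0) \<and>
                      F z =
                        Gamma (\<beta> q) / (Gamma (\<alpha> p) * Gamma (\<beta> q - \<alpha> p)) *
                        (LBINT t:{0<..<1}.
                           of_real t powr (\<alpha> p - 1) * of_real (1 - t) powr (\<beta> q - \<alpha> p - 1) *
                           G (z * of_real t) * \<Theta> 0))))"
proof -
  obtain P where p: "p = Suc P" using assms(2) by (cases p) auto
  obtain Q where q: "q = Suc Q" using assms(3) by (cases q) auto
  have PQ: "P \<le> Q + 1" using assms(4) p q by simp
  have params: "ext_pFq_params (Suc P) (Suc Q) \<alpha> \<beta>" using assms(7) p q by simp
  have int: "set_integrable lborel {0<..<1} (ext_beta_integrand \<Theta> b d x y)"
    if "Re b \<ge> 0" "Re d \<ge> 0" "Re x > 0" "Re y > 0" for b d x y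
    using assms(1) that by (auto simp: ext_kernel_def)
  define x y where "x = \<alpha> (Suc P)" and "y = \<beta> (Suc Q) - \<alpha> (Suc P)"
  \<comment> \<open>Euler's \<open>Beta x y = Gamma x * Gamma y / Gamma (x + y)\<close>, with
    \<open>x + y = \<beta> q\<close>.\<close>
  have const: "Gamma (\<beta> q) / (Gamma (\<alpha> p) * Gamma (\<beta> q - \<alpha> p)) * I = I / Beta x y" for I
    by (simp add: Beta_def x_def y_def p q)
  have integrand: "of_real t powr (\<alpha> p - 1) * of_real (1 - t) powr (\<beta> q - \<alpha> p - 1) * H *
      \<Theta> (- (b / of_real t) - d / of_real (1 - t)) = H * ext_beta_integrand \<Theta> b d x y t" for t H b d
    by (simp add: ext_beta_integrand_def x_def y_def p q mult_ac)
  \<comment> \<open>With \<open>b = d = 0\<close> both fractions vanish and the kernel is the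
    constant \<open>\<Theta> 0\<close>.\<close>
  have integrand_0: "of_real t powr (\<alpha> p - 1) * of_real (1 - t) powr (\<beta> q - \<alpha> p - 1) * H * \<Theta> 0
      = H * ext_beta_integrand \<Theta> 0 0 x y t" for t H
    using integrand[of t H 0 0] by simp
  show ?thesis
    unfolding const integrand integrand_0
  proof (intro conjI allI impI, goal_cases)
    \<comment> \<open>Both alternatives for \<open>b\<close> and \<open>d\<close> give nonnegative
      real parts, as \<open>int\<close> requires.\<close>
    case (1 b d z)
    then show ?case
      using ext_pFq_Suc_integral(1)[OF int PQ, of b d \<alpha> \<beta> z] by (auto simp: p q x_def y_def)
  next
    case (2 b d z)
    then show ?case
      using ext_pFq_Suc_integral(2)[OF int PQ, of b d \<alpha> \<beta> z] by (auto simp: p q x_def y_def)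
  next
    case 3
    then have P: "P = Suc Q" by (simp add: p q)
    have int0: "set_integrable lborel {0<..<1} (ext_beta_integrand \<Theta> 0 0 x y)"
      if "Re x > 0" "Re y > 0" for x y
      using int that by simp
    have par: "ext_pFq_params (Suc (Suc Q)) (Suc Q) \<alpha> \<beta>" using params by (simp add: P)
    then have "ext_pFq_params (Suc Q) Q \<alpha> \<beta>" by (simp add: ext_pFq_params_Suc)
    then obtain G where G: "continues_to_cut_plane (\<lambda>u. ext_pFq \<Theta> (Suc Q) Q \<alpha> \<beta> u 0 0) G"
      using continues_to_cut_plane_exists[OF int0] by blast
    \<comment> \<open>The witness for \<open>F\<close> is the normalized integral of
      \<open>G\<close> itself, so the formula holds by construction; that it continues the series is
      the content of \<open>continues_to_cut_plane_Suc\<close>.\<close>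
    show ?case
      using continues_to_cut_plane_Suc[OF int0 par G] G
      by (intro exI[of _ "\<lambda>z. (LBINT t:{0<..<1}. G (z * of_real t) * ext_beta_integrand \<Theta> 0 0 x y t) / Beta x y"]
            exI[of _ G]) (simp add: p q P x_def y_def)
  qed
qed

end
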